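(* Let $\Omega$ be a Polish metric space and let $\mathbb{M}$ be a finite Borel measure over $\Omega$. Then $C_{b,u}(\Omega)$ is dense in $L^{0}(\mathbb{M})$ with respect to the convergence-in-measure topology of $L^{0}(\mathbb{M})$.
   Context: A Polish metric space is a metric space that is complete and separable with respect to its given metric. A Borel measure over a metric space $\Omega$ is a measure defined on the Borel sigma-algebra of $\Omega$ (generated by the topology induced by the given metric). $L^{0}(\mathbb{M})$ denotes the collection of all Borel functions $\Omega \to \mathbb{R}$ (actual functions, not equivalence classes), and $C_{b,u}(\Omega)$ denotes the collection of all bounded, uniformly continuous functions $\Omega \to \mathbb{R}$. The convergence-in-measure topology of $L^{0}(\mathbb{M})$ is the topology generated by the subsets $$\{ g \in L^{0}(\mathbb{M}) \mid \inf \{ r \in [0,+\infty] \mid \mathbb{M}(\{x \in \Omega \mid |f(x)-g(x)| \geq r\}) < r \} < \varepsilon \},$$ where $f \in L^{0}(\mathbb{M})$ and $\varepsilon > 0$. *)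

theory Defs
  imports "HOL-Analysis.Analysis"
begin

text \<open>
  Elements of \<open>L0 M\<close> are actual Borel functions; no quotient by equality almost everywhere is taken.
\<close>

definition L0 :: "'a measure \<Rightarrow> ('a \<Rightarrow> real) set" where
  "L0 M = borel_measurable M"

definition C_bu :: "('a::metric_space \<Rightarrow> real) set" where
  "C_bu = {f. bounded (range f) \<and> uniformly_continuous_on UNIV f}"

text \<open>
  The infimum ranges over all \<open>r\<close> in \<open>[0,\<infinity>]\<close>, which is the type \<^typ>\<open>ennreal\<close>.
\<close>

definition measure_gauge :: "'a measure \<Rightarrow> ('a \<Rightarrow> real) \<Rightarrow> ('a \<Rightarrow> real) \<Rightarrow> ennreal" where
  "measure_gauge M f g =
     Inf {r. emeasure M {x \<in> space M. ennreal \<bar>f x - g x\<bar> \<ge> r} < r}"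

text \<open>
  The balls below are used as a subbase. The carrier of the resulting topology is their union,
  which is \<open>L0 M\<close> because \<open>measure_gauge M f f = 0\<close> (lemma \<open>topspace_conv_in_measure\<close>).
\<close>

definition conv_in_measure_topology :: "'a measure \<Rightarrow> ('a \<Rightarrow> real) topology" where
  "conv_in_measure_topology M =
     topology_generated_by
       {{g \<in> L0 M. measure_gauge M f g < ennreal \<epsilon>} | f \<epsilon>. f \<in> L0 M \<and> \<epsilon> > (0::real)}"

lemma measure_gauge_refl: "measure_gauge M f f = 0"
proof -
  have "measure_gauge M f f \<le> r" if "r > 0" for r :: ennreal
  proof -
    have "{x \<in> space M. ennreal \<bar>f x - f x\<bar> \<ge> r} = {}"
      using that by (auto simp: not_le)
    then show ?thesis
      unfolding measure_gauge_def using that by (intro Inf_lower) (simp only: mem_Collect_eq emeasure_empty)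
  qed
  then show ?thesis
    by (meson dense_le linorder_not_less not_gr_zero dense)
qed

lemma topspace_conv_in_measure: "topspace (conv_in_measure_topology M) = L0 M"
proof -
  have "f \<in> \<Union>{{g \<in> L0 M. measure_gauge M f g < ennreal \<epsilon>} | f \<epsilon>. f \<in> L0 M \<and> \<epsilon> > (0::real)}"
    if "f \<in> L0 M" for f
  proof (rule UnionI)
    show "{g \<in> L0 M. measure_gauge M f g < ennreal 1}
        \<in> {{g \<in> L0 M. measure_gauge M f g < ennreal \<epsilon>} | f \<epsilon>. f \<in> L0 M \<and> \<epsilon> > (0::real)}"
      using that zero_less_one by blast
    show "f \<in> {g \<in> L0 M. measure_gauge M f g < ennreal 1}"
      using that by (simp add: measure_gauge_refl)
  qed
  then show ?thesis
    unfolding conv_in_measure_topology_def topology_generated_by_topspace by blast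
qed

end

theory Submission
  imports Defs
begin

text \<open>
  Call \<open>f\<close> approximable if for every \<open>\<epsilon> > 0\<close> some \<open>g \<in> C_bu\<close> satisfies
  \<open>\<bar>f - g\<bar> < \<epsilon>\<close> outside a set of measure less than \<open>\<epsilon>\<close>. Approximable functions are closed under
  linear combinations, because \<open>C_bu\<close> is a vector space, and under pointwise limits of sequences,
  because on a finite measure space pointwise convergence implies convergence in measure
  (\<open>approximable_limit\<close>).

  These two closure properties reduce everything to indicators of closed sets: the sets with
  approximable indicator form a Dynkin system, the closed sets form an intersection-stable generator
  of the Borel sets, and every Borel function arises from indicators of Borel sets by linear
  combinations and monotone limits (\<open>approximable_borel_measurable\<close>). The indicator of a closed set
  \<open>A\<close> is in turn the pointwise limit of the bounded Lipschitz functions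
  \<open>x \<mapsto> max 0 (1 - n * infdist x A)\<close>, where \<open>infdist x A\<close> is the distance from \<open>x\<close> to \<open>A\<close>.

  It remains to see that approximability at \<open>f\<close> amounts to membership in the closure. The topology
  is generated by balls with arbitrary centres, and their finite intersections have to be compared
  with balls centred at \<open>f\<close>. The gauge satisfies the triangle inequality
  (\<open>measure_gauge_triangle_less\<close>), so every open neighbourhood of \<open>f\<close> contains such a ball.
\<close>

section \<open>Neighbourhoods in the topology of convergence in measure\<close>

text \<open>
  If \<open>r\<close> is admissible for \<open>(f, g)\<close> and \<open>s\<close> for \<open>(g, h)\<close>, then \<open>r + s\<close> is admissible for \<open>(f, h)\<close>:
  a deviation of at least \<open>r + s\<close> forces one of the two parts to be large, so the exceptional sets
  are covered by a union and their measures add up. With strict bounds on both gauges the admissible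
  values can be chosen finite, where addition is strictly monotone.
\<close>

lemma measure_gauge_triangle_less:
  assumes "f \<in> borel_measurable M" "g \<in> borel_measurable M" "h \<in> borel_measurable M"
    and fg: "measure_gauge M f g < ennreal a" and gh: "measure_gauge M g h < ennreal b"
  shows "measure_gauge M f h < ennreal (a + b)"
proof -
  let ?S = "\<lambda>u v r. {x \<in> space M. ennreal \<bar>u x - v x\<bar> \<ge> r}"
  note [measurable] = assms(1-3)
  obtain r where r: "emeasure M (?S f g r) < r" "r < ennreal a"
    using fg unfolding measure_gauge_def Inf_less_iff by blast
  obtain s where s: "emeasure M (?S g h s) < s" "s < ennreal b"
    using gh unfolding measure_gauge_def Inf_less_iff by blast
  obtain r' where r': "r = ennreal r'" "0 \<le> r'"
    using r(2) by (cases r) auto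
  obtain s' where s': "s = ennreal s'" "0 \<le> s'"
    using s(2) by (cases s) auto
  have add_less: "u + v < r + s" if "u < r" "v < s" for u v
    using add_mono_ennreal[of u r' v s'] that r' s' by simp
  have "?S f h (r + s) \<subseteq> ?S f g r \<union> ?S g h s"
  proof
    fix x assume x: "x \<in> ?S f h (r + s)"
    have "ennreal \<bar>f x - h x\<bar> \<le> ennreal \<bar>f x - g x\<bar> + ennreal \<bar>g x - h x\<bar>"
      by (simp flip: ennreal_plus)
    then show "x \<in> ?S f g r \<union> ?S g h s"
      using x add_less[of "ennreal \<bar>f x - g x\<bar>" "ennreal \<bar>g x - h x\<bar>"]
      by (auto simp flip: not_less)
  qed
  then have "emeasure M (?S f h (r + s)) \<le> emeasure M (?S f g r \<union> ?S g h s)"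
    by (intro emeasure_mono) auto
  also have "\<dots> \<le> emeasure M (?S f g r) + emeasure M (?S g h s)"
    by (intro emeasure_subadditive) auto
  also have "\<dots> < r + s"
    using r(1) s(1) by (rule add_less)
  finally have "measure_gauge M f h \<le> r + s"
    unfolding measure_gauge_def by (intro Inf_lower) simp
  also have "\<dots> < ennreal (a + b)"
    using r(2) s(2) by (rule add_mono_ennreal)
  finally show ?thesis .
qed

text \<open>
  The property passes through finite intersections and arbitrary unions, so only the generating balls
  matter. A ball of radius \<open>\<epsilon>\<close> around \<open>c\<close> that contains \<open>f\<close> also contains the ball of radius
  \<open>\<epsilon> - r\<close> around \<open>f\<close>, for any \<open>r\<close> strictly between \<open>measure_gauge M c f\<close> and \<open>\<epsilon>\<close>.
\<close>

lemma openin_conv_in_measure_contains_ball: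
  assumes "openin (conv_in_measure_topology M) U" "f \<in> U"
  shows "\<exists>\<delta>>0. {g \<in> L0 M. measure_gauge M f g < ennreal \<delta>} \<subseteq> U"
proof -
  have "generate_topology_on
      {{g \<in> L0 M. measure_gauge M c g < ennreal \<epsilon>} | c \<epsilon>. c \<in> L0 M \<and> \<epsilon> > (0::real)} U"
    using assms(1) unfolding conv_in_measure_topology_def openin_topology_generated_by_iff .
  then show ?thesis
    using assms(2)
  proof induction
    case Empty
    then show ?case by simp
  next
    case (Int A B)
    then obtain a b where ab: "a > 0" "{g \<in> L0 M. measure_gauge M f g < ennreal a} \<subseteq> A"
      "b > 0" "{g \<in> L0 M. measure_gauge M f g < ennreal b} \<subseteq> B"
      by blast
    have "t < ennreal a \<and> t < ennreal b" if "t < ennreal (min a b)" for t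
      using that by (auto simp: min_def ennreal_leI intro: less_le_trans split: if_splits)
    with ab show ?case
      by (intro exI[of _ "min a b"]) (auto 4 3)
  next
    case (UN K)
    then show ?case by (meson Sup_upper UnionE subset_trans)
  next
    case (Basis S)
    then obtain c \<epsilon> where c: "c \<in> L0 M" "S = {g \<in> L0 M. measure_gauge M c g < ennreal \<epsilon>}"
      by blast
    then have f: "f \<in> L0 M" "measure_gauge M c f < ennreal \<epsilon>"
      using Basis by auto
    obtain t where t: "measure_gauge M c f < t" "t < ennreal \<epsilon>"
      using dense[OF f(2)] by blast
    obtain r where r: "t = ennreal r" "0 \<le> r"
      using t(2) by (cases t) auto
    have "r < \<epsilon>"
      using t(2) r by (simp add: ennreal_less_iff)
    moreover have "g \<in> S" if "g \<in> L0 M" "measure_gauge M f g < ennreal (\<epsilon> - r)" for g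
      using measure_gauge_triangle_less[of c M f g r "\<epsilon> - r"] that c f t(1) r
      by (simp add: L0_def)
    ultimately show ?case
      by (intro exI[of _ "\<epsilon> - r"]) auto
  qed
qed

section \<open>Functions approximable by bounded uniformly continuous functions\<close>

lemma C_bu_measurable:
  assumes "sets M = sets borel"
  shows "C_bu \<subseteq> borel_measurable M"
  unfolding C_bu_def measurable_cong_sets[OF assms refl]
  by (auto intro!: borel_measurable_continuous_onI uniformly_continuous_imp_continuous)

lemma C_bu_const: "(\<lambda>x. c) \<in> C_bu"
  by (simp add: C_bu_def uniformly_continuous_on_const)

lemma C_bu_add: "f \<in> C_bu \<Longrightarrow> g \<in> C_bu \<Longrightarrow> (\<lambda>x. f x + g x) \<in> C_bu"
  unfolding C_bu_def by (auto intro: bounded_plus_comp uniformly_continuous_on_add)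

lemma C_bu_cmult: "f \<in> C_bu \<Longrightarrow> (\<lambda>x. c * f x) \<in> C_bu"
  unfolding C_bu_def
  using bounded_scaleR_comp[of f UNIV c] uniformly_continuous_on_cmul[of UNIV f c]
  unfolding real_scaleR_def by blast

definition approximable :: "'a::metric_space measure \<Rightarrow> ('a \<Rightarrow> real) \<Rightarrow> bool" where
  "approximable M f \<longleftrightarrow> f \<in> borel_measurable M \<and>
     (\<forall>\<epsilon>>0. \<exists>g\<in>C_bu. measure M {x \<in> space M. \<epsilon> \<le> \<bar>f x - g x\<bar>} < \<epsilon>)"

lemma approximable_C_bu:
  assumes "sets M = sets borel" "f \<in> C_bu"
  shows "approximable M f"
  unfolding approximable_def
proof (intro conjI allI impI bexI[OF _ assms(2)])
  show "f \<in> borel_measurable M"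
    using C_bu_measurable assms by blast
  show "measure M {x \<in> space M. \<epsilon> \<le> \<bar>f x - f x\<bar>} < \<epsilon>" if "0 < \<epsilon>" for \<epsilon>
    using that by (simp add: not_le[symmetric])
qed

lemma approximable_add:
  assumes M: "sets M = sets borel" "finite_measure M"
    and f: "approximable M f" and g: "approximable M g"
  shows "approximable M (\<lambda>x. f x + g x)"
proof -
  interpret finite_measure M by fact
  have [measurable]: "f \<in> borel_measurable M" "g \<in> borel_measurable M"
    using f g by (auto simp: approximable_def)
  have "\<exists>h\<in>C_bu. measure M {x \<in> space M. \<epsilon> \<le> \<bar>f x + g x - h x\<bar>} < \<epsilon>" if "\<epsilon> > 0" for \<epsilon>
  proof -
    have "\<epsilon> / 2 > 0" using that by simp
    then obtain u v where u: "u \<in> C_bu" "measure M {x \<in> space M. \<epsilon> / 2 \<le> \<bar>f x - u x\<bar>} < \<epsilon> / 2"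
      and v: "v \<in> C_bu" "measure M {x \<in> space M. \<epsilon> / 2 \<le> \<bar>g x - v x\<bar>} < \<epsilon> / 2"
      using f g unfolding approximable_def by meson
    have [measurable]: "u \<in> borel_measurable M" "v \<in> borel_measurable M"
      using u(1) v(1) C_bu_measurable[OF M(1)] by auto
    have "measure M {x \<in> space M. \<epsilon> \<le> \<bar>f x + g x - (u x + v x)\<bar>}
        \<le> measure M ({x \<in> space M. \<epsilon> / 2 \<le> \<bar>f x - u x\<bar>} \<union> {x \<in> space M. \<epsilon> / 2 \<le> \<bar>g x - v x\<bar>})"
      by (intro finite_measure_mono) (auto simp: abs_if split: if_splits)
    also have "\<dots> \<le> measure M {x \<in> space M. \<epsilon> / 2 \<le> \<bar>f x - u x\<bar>}
        + measure M {x \<in> space M. \<epsilon> / 2 \<le> \<bar>g x - v x\<bar>}"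
      by (intro measure_Un_le) auto
    also have "\<dots> < \<epsilon>"
      using u v by simp
    finally show ?thesis
      by (intro bexI[OF _ C_bu_add[OF u(1) v(1)]])
  qed
  then show ?thesis
    by (simp add: approximable_def)
qed

lemma approximable_cmult:
  assumes M: "sets M = sets borel" "finite_measure M" and f: "approximable M f"
  shows "approximable M (\<lambda>x. c * f x)"
proof -
  interpret finite_measure M by fact
  have [measurable]: "f \<in> borel_measurable M"
    using f by (auto simp: approximable_def)
  have "\<exists>h\<in>C_bu. measure M {x \<in> space M. \<epsilon> \<le> \<bar>c * f x - h x\<bar>} < \<epsilon>" if "\<epsilon> > 0" for \<epsilon>
  proof -
    \<comment> \<open>The parameter bounds both the error, which is scaled by \<open>\<bar>c\<bar>\<close>, and the measure of the
      exceptional set, which is not; adding 1 to \<open>\<bar>c\<bar>\<close> makes one choice serve both bounds.\<close>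
    define \<delta> where "\<delta> = \<epsilon> / (\<bar>c\<bar> + 1)"
    have \<delta>: "\<delta> > 0" "\<delta> \<le> \<epsilon>" "\<bar>c\<bar> * \<delta> < \<epsilon>"
      using that by (auto simp: \<delta>_def field_simps add_pos_nonneg)
    obtain u where u: "u \<in> C_bu" "measure M {x \<in> space M. \<delta> \<le> \<bar>f x - u x\<bar>} < \<delta>"
      using f \<delta>(1) unfolding approximable_def by meson
    have [measurable]: "u \<in> borel_measurable M"
      using u(1) C_bu_measurable[OF M(1)] by auto
    have "\<delta> \<le> \<bar>f x - u x\<bar>" if "\<epsilon> \<le> \<bar>c * f x - c * u x\<bar>" for x
    proof (rule ccontr)
      assume "\<not> \<delta> \<le> \<bar>f x - u x\<bar>"
      then have "\<bar>c\<bar> * \<bar>f x - u x\<bar> \<le> \<bar>c\<bar> * \<delta>"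
        by (intro mult_left_mono) auto
      with that \<delta>(3) show False
        by (simp add: abs_mult right_diff_distrib flip: abs_mult)
    qed
    then have "measure M {x \<in> space M. \<epsilon> \<le> \<bar>c * f x - c * u x\<bar>}
        \<le> measure M {x \<in> space M. \<delta> \<le> \<bar>f x - u x\<bar>}"
      by (intro finite_measure_mono) auto
    with u(2) \<delta>(2) show ?thesis
      by (intro bexI[OF _ C_bu_cmult[OF u(1), of c]]) linarith
  qed
  then show ?thesis
    by (simp add: approximable_def)
qed

text \<open>
  The sets where some later term still deviates by \<open>\<epsilon>/2\<close> decrease to the empty set, so their
  measures tend to \<open>0\<close> by continuity from above, for which finiteness of the measure is essential.
  Hence a single term of the sequence is close to the limit in measure, and it remains to
  approximate that term.
\<close>

lemma approximable_limit:
  assumes M: "sets M = sets borel" "finite_measure M"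
    and U: "\<And>i::nat. approximable M (U i)"
    and lim: "\<And>x. x \<in> space M \<Longrightarrow> (\<lambda>i. U i x) \<longlonglongrightarrow> f x"
  shows "approximable M f"
proof -
  interpret finite_measure M by fact
  have U_meas[measurable]: "U i \<in> borel_measurable M" for i
    using U by (auto simp: approximable_def)
  have f_meas[measurable]: "f \<in> borel_measurable M"
    using lim U_meas by (rule borel_measurable_LIMSEQ_real)
  have "\<exists>h\<in>C_bu. measure M {x \<in> space M. \<epsilon> \<le> \<bar>f x - h x\<bar>} < \<epsilon>" if "\<epsilon> > 0" for \<epsilon>
  proof -
    have half: "\<epsilon> / 2 > 0" using that by simp
    define A where "A n = {x \<in> space M. \<exists>i\<ge>n. \<epsilon> / 2 \<le> \<bar>f x - U i x\<bar>}" for n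
    have [measurable]: "A n \<in> sets M" for n
      unfolding A_def by measurable
    have "decseq A"
      unfolding decseq_def A_def by (blast intro: order_trans)
    then have "(\<lambda>n. measure M (A n)) \<longlonglongrightarrow> measure M (\<Inter>n. A n)"
      by (intro finite_Lim_measure_decseq) auto
    moreover have "x \<notin> (\<Inter>n. A n)" for x
    proof
      assume x: "x \<in> (\<Inter>n. A n)"
      then have "x \<in> space M" by (auto simp: A_def)
      then obtain n where "\<forall>i\<ge>n. \<bar>U i x - f x\<bar> < \<epsilon> / 2"
        using LIMSEQ_D[OF lim half, of x] by auto
      with x show False
        by (auto simp: A_def abs_minus_commute not_le[symmetric])
    qed
    then have "(\<Inter>n. A n) = {}" by blast
    ultimately have "(\<lambda>n. measure M (A n)) \<longlonglongrightarrow> 0"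
      by simp
    from order_tendstoD(2)[OF this half]
    obtain n where n: "measure M (A n) < \<epsilon> / 2"
      by (auto simp: eventually_sequentially)
    obtain u where u: "u \<in> C_bu" "measure M {x \<in> space M. \<epsilon> / 2 \<le> \<bar>U n x - u x\<bar>} < \<epsilon> / 2"
      using U half unfolding approximable_def by meson
    have [measurable]: "u \<in> borel_measurable M"
      using u(1) C_bu_measurable[OF M(1)] by auto
    have "x \<in> A n \<or> \<epsilon> / 2 \<le> \<bar>U n x - u x\<bar>" if "x \<in> space M" "\<epsilon> \<le> \<bar>f x - u x\<bar>" for x
    proof (rule disjCI)
      assume "\<not> \<epsilon> / 2 \<le> \<bar>U n x - u x\<bar>"
      with that(2) have "\<epsilon> / 2 \<le> \<bar>f x - U n x\<bar>"
        by linarith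
      with that(1) show "x \<in> A n"
        by (auto simp: A_def)
    qed
    then have "measure M {x \<in> space M. \<epsilon> \<le> \<bar>f x - u x\<bar>}
        \<le> measure M (A n \<union> {x \<in> space M. \<epsilon> / 2 \<le> \<bar>U n x - u x\<bar>})"
      by (intro finite_measure_mono) auto
    also have "\<dots> \<le> measure M (A n) + measure M {x \<in> space M. \<epsilon> / 2 \<le> \<bar>U n x - u x\<bar>}"
      by (intro measure_Un_le) auto
    also have "\<dots> < \<epsilon>"
      using n u by simp
    finally show ?thesis
      using u(1) by blast
  qed
  then show ?thesis
    by (simp add: approximable_def)
qed

section \<open>Every Borel function is approximable\<close>

lemma C_bu_infdist_cutoff: "(\<lambda>x. max 0 (1 - real n * infdist x A)) \<in> C_bu"
proof -
  let ?g = "\<lambda>x. max 0 (1 - real n * infdist x A)"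
  have "\<bar>?g x - ?g y\<bar> \<le> real n * dist x y" for x y
  proof -
    have "\<bar>?g x - ?g y\<bar> \<le> \<bar>real n * (infdist x A - infdist y A)\<bar>"
      by (simp add: right_diff_distrib)
    also have "\<dots> \<le> real n * dist x y"
      by (simp add: abs_mult infdist_triangle_abs mult_left_mono)
    finally show ?thesis .
  qed
  then have "(real n)-lipschitz_on UNIV ?g"
    by (intro lipschitz_onI) (auto simp: dist_real_def)
  then have "uniformly_continuous_on UNIV ?g"
    by (rule lipschitz_on_uniformly_continuous)
  moreover have "norm (?g x) \<le> 1" for x
    using infdist_nonneg[of x A] by simp
  then have "bounded (range ?g)"
    unfolding bounded_iff by blast
  ultimately show ?thesis
    by (simp add: C_bu_def)
qed

lemma approximable_indicator_closed:
  assumes M: "sets M = sets borel" "finite_measure M" and A: "closed A"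
  shows "approximable M (indicator A)"
proof (cases "A = {}")
  \<comment> \<open>The distance to the empty set is \<open>0\<close> by convention, so the cutoffs do not tend to its
    indicator.\<close>
  case True
  then show ?thesis
    using approximable_C_bu[OF M(1) C_bu_const[of 0]] by (simp add: indicator_def [abs_def])
next
  case False
  show ?thesis
  proof (rule approximable_limit[OF M approximable_C_bu[OF M(1) C_bu_infdist_cutoff]])
    fix x
    show "(\<lambda>n. max 0 (1 - real n * infdist x A)) \<longlonglongrightarrow> indicator A x"
    proof (cases "x \<in> A")
      case True
      then show ?thesis by simp
    next
      case x: False
      have pos: "infdist x A > 0"
        using infdist_pos_not_in_closed[OF A False x] .
      obtain N :: nat where N: "1 / infdist x A < real N"
        using reals_Archimedean2 by blast
      have "max 0 (1 - real n * infdist x A) = indicator A x" if "n \<ge> N" for n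
      proof -
        have "1 / infdist x A < real n" using N that by linarith
        then have "1 < real n * infdist x A" using pos by (simp add: field_simps)
        then show ?thesis using x by simp
      qed
      then show ?thesis
        by (intro tendsto_eventually) (auto simp: eventually_sequentially)
    qed
  qed
qed

lemma approximable_indicator:
  assumes M: "sets M = sets borel" "finite_measure M" and A: "A \<in> sets M"
  shows "approximable M (indicator A)"
proof -
  have "Int_stable (Collect closed)" "Collect closed \<subseteq> Pow UNIV"
    by (auto simp: Int_stable_def)
  moreover have "A \<in> sigma_sets UNIV (Collect closed)"
    using A M(1) by (simp add: borel_eq_closed)
  ultimately show ?thesis
  proof (induction A rule: sigma_sets_induct_disjoint)
    case (basic A)
    then show ?case
      using approximable_indicator_closed[OF M] by simp
  next
    case empty
    show ?case
      by (rule approximable_indicator_closed[OF M closed_empty])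
  next
    case (compl A)
    have "approximable M (\<lambda>x. 1 + (- 1) * indicator A x)"
      using approximable_add[OF M approximable_C_bu[OF M(1) C_bu_const[of 1]]
          approximable_cmult[OF M compl(2), of "- 1"]] .
    moreover have "(\<lambda>x. 1 + (- 1) * indicator A x) = (indicator (UNIV - A) :: _ \<Rightarrow> real)"
      by (auto simp: indicator_def)
    ultimately show ?case by simp
  next
    case (union D)
    have "approximable M (indicator (\<Union>i<n. D i))" for n
    proof (induction n)
      case 0
      have "closed (\<Union>i<0::nat. D i)"
        by simp
      then show ?case
        by (rule approximable_indicator_closed[OF M])
    next
      case (Suc n)
      have "D i \<inter> D n = {}" if "i < n" for i
        using disjoint_family_onD[OF union(1), of i n] that by simp
      then have disj: "(\<Union>i<n. D i) \<inter> D n = {}"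
        by blast
      have "(\<Union>i<Suc n. D i) = (\<Union>i<n. D i) \<union> D n"
        by (simp add: lessThan_Suc Un_commute)
      then have "(indicator (\<Union>i<Suc n. D i) :: _ \<Rightarrow> real) =
          (\<lambda>x. indicator (\<Union>i<n. D i) x + indicator (D n) x)"
        by (simp only: indicator_disj_union[OF disj] fun_eq_iff) simp
      then show ?case
        using approximable_add[OF M Suc union(3)[of n]] by (simp only:)
    qed
    then show ?case
      by (rule approximable_limit[OF M]) (rule LIMSEQ_indicator_UN)
  qed
qed

lemma approximable_borel_measurable:
  assumes M: "sets M = sets borel" "finite_measure M" and f: "f \<in> borel_measurable M"
  shows "approximable M f"
proof -
  have nonneg: "approximable M u" if "u \<in> borel_measurable M" "\<And>x. 0 \<le> u x" for u
    using that
  proof (induction rule: borel_measurable_induct_real)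
    case (set A)
    then show ?case by (rule approximable_indicator[OF M])
  next
    case (mult u c)
    then show ?case by (intro approximable_cmult[OF M])
  next
    case (add u v)
    then show ?case by (intro approximable_add[OF M])
  next
    case (seq U)
    show ?case by (rule approximable_limit[OF M, where U = U]) (use seq in auto)
  qed
  have "approximable M (\<lambda>x. max 0 (f x) + (- 1) * max 0 (- f x))"
    using f by (intro approximable_add[OF M] approximable_cmult[OF M] nonneg) auto
  moreover have "(\<lambda>x. max 0 (f x) + (- 1) * max 0 (- f x)) = f"
    by (auto simp: max_def)
  ultimately show ?thesis by simp
qed

text \<open>
  Taking \<open>r = \<epsilon>/2\<close> in the infimum defining the gauge gives a bound strictly below \<open>\<epsilon>\<close>.
\<close>

lemma approximable_imp_measure_gauge_less:
  assumes "finite_measure M" "approximable M f" "\<epsilon> > 0"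
  shows "\<exists>g\<in>C_bu. measure_gauge M f g < ennreal \<epsilon>"
proof -
  interpret finite_measure M by fact
  have half: "\<epsilon> / 2 > 0" using assms(3) by simp
  then obtain g where g: "g \<in> C_bu" "measure M {x \<in> space M. \<epsilon> / 2 \<le> \<bar>f x - g x\<bar>} < \<epsilon> / 2"
    using assms(2) unfolding approximable_def by meson
  have "measure_gauge M f g \<le> ennreal (\<epsilon> / 2)"
    unfolding measure_gauge_def
    using g(2) half by (intro Inf_lower) (simp add: emeasure_eq_measure ennreal_less_iff)
  also have "\<dots> < ennreal \<epsilon>"
    using half by (simp add: ennreal_less_iff)
  finally show ?thesis
    using g(1) by blast
qed

theorem theorem2:
  fixes M :: "'a::polish_space measure"
  assumes "sets M = sets borel" and "finite_measure M"
  shows "C_bu \<subseteq> L0 M \<and> conv_in_measure_topology M closure_of C_bu = L0 M"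
proof
  show sub: "C_bu \<subseteq> L0 M"
    using C_bu_measurable[OF assms(1)] by (simp add: L0_def)
  have "f \<in> conv_in_measure_topology M closure_of C_bu" if f: "f \<in> L0 M" for f
    unfolding in_closure_of topspace_conv_in_measure
  proof (intro conjI f allI impI)
    fix U assume "f \<in> U \<and> openin (conv_in_measure_topology M) U"
    then obtain \<delta> where \<delta>: "\<delta> > 0" "{g \<in> L0 M. measure_gauge M f g < ennreal \<delta>} \<subseteq> U"
      using openin_conv_in_measure_contains_ball by blast
    have "approximable M f"
      using approximable_borel_measurable[OF assms] f by (simp add: L0_def)
    from approximable_imp_measure_gauge_less[OF assms(2) this \<delta>(1)] \<delta>(2) sub
    show "\<exists>g. g \<in> C_bu \<and> g \<in> U"
      by blast
  qed
  then show "conv_in_measure_topology M closure_of C_bu = L0 M"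
    using closure_of_subset_topspace[of "conv_in_measure_topology M" C_bu]
    by (auto simp: topspace_conv_in_measure)
qed

end
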